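(* Let $\lambda\neq 0$ and let $X$ be the vector field associated with the real analytic system $\dot x=y+P(x,y,z)$, $\dot y=Q(x,y,z)$, $\dot z=-\lambda z+R(x,y,z)$, with $j^1P(0)=j^1Q(0)=j^1R(0)=0$. Then there exists a formal series $H(x,y,z)=y^2+\sum_{n\geqslant 3}H_n(x,y,z)$, with $H_n$ a homogeneous polynomial of degree $n$, such that $$XH=\sum_{n\geqslant 4}\omega_nx^n$$ for some real numbers $\omega_n$.
   Context: $j^1G(0)$ denotes the Taylor polynomial of degree $1$ of $G$ at the origin. $XH=(y+P)\frac{\partial H}{\partial x}+Q\frac{\partial H}{\partial y}+(-\lambda z+R)\frac{\partial H}{\partial z}$, computed as formal power series. *)

theory Defs
  imports "HOL-Analysis.Analysis" "HOL-Computational_Algebra.Formal_Power_Series"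
begin

text \<open>
  Formal power series in \<open>x, y, z\<close> are iterated univariate ones: the outermost layer carries the
  powers of \<open>x\<close>, the middle one those of \<open>y\<close>, the innermost one those of \<open>z\<close>. Sums and products
  are those of the library's ring of formal power series.
\<close>

type_synonym fps3 = "real fps fps fps"

definition coeff3 :: "fps3 \<Rightarrow> nat \<Rightarrow> nat \<Rightarrow> nat \<Rightarrow> real" where
  "coeff3 F i j k = fps_nth (fps_nth (fps_nth F i) j) k"

definition Abs_fps3 :: "(nat \<Rightarrow> nat \<Rightarrow> nat \<Rightarrow> real) \<Rightarrow> fps3" where
  "Abs_fps3 c = Abs_fps (\<lambda>i. Abs_fps (\<lambda>j. Abs_fps (\<lambda>k. c i j k)))"

definition const3 :: "real \<Rightarrow> fps3" where
  "const3 c = fps_const (fps_const (fps_const c))"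

definition var_x :: fps3 where "var_x = fps_X"
definition var_y :: fps3 where "var_y = fps_const fps_X"
definition var_z :: fps3 where "var_z = fps_const (fps_const fps_X)"

definition fdiff_x :: "fps3 \<Rightarrow> fps3" where
  "fdiff_x F = fps_deriv F"
definition fdiff_y :: "fps3 \<Rightarrow> fps3" where
  "fdiff_y F = Abs_fps (\<lambda>i. fps_deriv (fps_nth F i))"
definition fdiff_z :: "fps3 \<Rightarrow> fps3" where
  "fdiff_z F = Abs_fps (\<lambda>i. Abs_fps (\<lambda>j. fps_deriv (fps_nth (fps_nth F i) j)))"

definition homogeneous3 :: "nat \<Rightarrow> fps3 \<Rightarrow> bool" where
  "homogeneous3 n F \<longleftrightarrow> (\<forall>i j k. coeff3 F i j k \<noteq> 0 \<longrightarrow> i + j + k = n)"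

text \<open>
  \<open>S\<close> is the formal sum of \<open>F n\<close> over \<open>n \<ge> m\<close>: every coefficient of the partial sums is eventually
  constant, with value the coefficient of \<open>S\<close>. (The library's metric on \<open>fps\<close> sees only the powers
  of the outermost variable, so \<open>sums\<close> would not express this.)
\<close>

definition formal_sums_from :: "nat \<Rightarrow> (nat \<Rightarrow> fps3) \<Rightarrow> fps3 \<Rightarrow> bool" where
  "formal_sums_from m F S \<longleftrightarrow>
     (\<forall>i j k. eventually (\<lambda>N. coeff3 (\<Sum>n=m..N. F n) i j k = coeff3 S i j k) sequentially)"

definition real_analytic_on3 :: "(real \<times> real \<times> real \<Rightarrow> real) \<Rightarrow> (real \<times> real \<times> real) set \<Rightarrow> bool"
where
  "real_analytic_on3 f U \<longleftrightarrow>
     (\<forall>(a, b, c)\<in>U. \<exists>C :: nat \<Rightarrow> nat \<Rightarrow> nat \<Rightarrow> real. \<exists>r>0. \<forall>x y z.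
        \<bar>x - a\<bar> < r \<and> \<bar>y - b\<bar> < r \<and> \<bar>z - c\<bar> < r \<longrightarrow>
        ((\<lambda>(i, j, k). C i j k * (x - a) ^ i * (y - b) ^ j * (z - c) ^ k) has_sum f (x, y, z)) UNIV)"

definition pderiv_x :: "(real \<times> real \<times> real \<Rightarrow> real) \<Rightarrow> real \<times> real \<times> real \<Rightarrow> real" where
  "pderiv_x f = (\<lambda>(x, y, z). deriv (\<lambda>t. f (t, y, z)) x)"
definition pderiv_y :: "(real \<times> real \<times> real \<Rightarrow> real) \<Rightarrow> real \<times> real \<times> real \<Rightarrow> real" where
  "pderiv_y f = (\<lambda>(x, y, z). deriv (\<lambda>t. f (x, t, z)) y)"
definition pderiv_z :: "(real \<times> real \<times> real \<Rightarrow> real) \<Rightarrow> real \<times> real \<times> real \<Rightarrow> real" where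
  "pderiv_z f = (\<lambda>(x, y, z). deriv (\<lambda>t. f (x, y, t)) z)"

definition taylor_series3 :: "(real \<times> real \<times> real \<Rightarrow> real) \<Rightarrow> fps3" where
  "taylor_series3 f = Abs_fps3 (\<lambda>i j k.
     (pderiv_x ^^ i) ((pderiv_y ^^ j) ((pderiv_z ^^ k) f)) (0, 0, 0) / (fact i * fact j * fact k))"

text \<open>The Taylor polynomial of degree \<open>n\<close> at the origin, as an element of the ring of formal series.\<close>

definition jet3 :: "nat \<Rightarrow> (real \<times> real \<times> real \<Rightarrow> real) \<Rightarrow> fps3" where
  "jet3 n f = Abs_fps3 (\<lambda>i j k. if i + j + k \<le> n then coeff3 (taylor_series3 f) i j k else 0)"

text \<open>
  The formal action on \<open>H\<close> of the vector field of
  \<open>x' = y + P, y' = Q, z' = - lam z + R\<close>, with \<open>P, Q, R\<close> expanded at the origin.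
\<close>

definition formal_vf ::
  "real \<Rightarrow> (real \<times> real \<times> real \<Rightarrow> real) \<Rightarrow> (real \<times> real \<times> real \<Rightarrow> real) \<Rightarrow>
   (real \<times> real \<times> real \<Rightarrow> real) \<Rightarrow> fps3 \<Rightarrow> fps3" where
  "formal_vf lam P Q R H =
     (var_y + taylor_series3 P) * fdiff_x H + taylor_series3 Q * fdiff_y H
       + (const3 (- lam) * var_z + taylor_series3 R) * fdiff_z H"

end

theory Submission
  imports Defs
begin

text \<open>
  Write \<open>X = L + N\<close> with \<open>L = y \<partial>\<^sub>x - \<lambda> z \<partial>\<^sub>z\<close>, which preserves the degree, and
  \<open>N = P \<partial>\<^sub>x + Q \<partial>\<^sub>y + R \<partial>\<^sub>z\<close>, which raises it. Comparing coefficients, every series without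
  pure powers of \<open>x\<close> is in the image of \<open>L\<close>: when there is no \<open>z\<close> one divides by the exponent of
  \<open>x\<close>, and otherwise one solves recursively in the exponent of \<open>y\<close>, dividing by \<open>\<lambda> k\<close>. Let \<open>S\<close> be
  the resulting degree-preserving right inverse of \<open>L\<close> modulo pure powers of \<open>x\<close>. Since
  \<open>F \<mapsto> y\<^sup>2 - S (N F)\<close> is a contraction for the degree filtration, it has a fixed point \<open>H\<close>, and as
  \<open>L y\<^sup>2 = 0\<close>, only pure powers of \<open>x\<close> survive in \<open>L H + N H\<close>. The power \<open>x\<^sup>3\<close> does not occur,
  because in degree \<open>3\<close> only \<open>N y\<^sup>2 = 2 y Q\<close> could contribute to it.
\<close>

subsection \<open>Coefficients and the degree filtration\<close>

lemma fps3_eqI: "(\<And>i j k. coeff3 F i j k = coeff3 G i j k) \<Longrightarrow> F = G"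
  by (simp add: coeff3_def fps_eq_iff)

lemma coeff3_Abs [simp]: "coeff3 (Abs_fps3 c) i j k = c i j k"
  by (simp add: coeff3_def Abs_fps3_def)

lemma coeff3_0 [simp]: "coeff3 0 i j k = 0"
  by (simp add: coeff3_def)

lemma coeff3_add [simp]: "coeff3 (F + G) i j k = coeff3 F i j k + coeff3 G i j k"
  by (simp add: coeff3_def)

lemma coeff3_diff [simp]: "coeff3 (F - G) i j k = coeff3 F i j k - coeff3 G i j k"
  by (simp add: coeff3_def)

lemma coeff3_sum [simp]: "coeff3 (\<Sum>n\<in>A. F n) i j k = (\<Sum>n\<in>A. coeff3 (F n) i j k)"
  by (simp add: coeff3_def fps_sum_nth)

lemma coeff3_mult:
  "coeff3 (F * G) i j k =
     (\<Sum>a=0..i. \<Sum>b=0..j. \<Sum>c=0..k. coeff3 F a b c * coeff3 G (i - a) (j - b) (k - c))"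
  by (simp add: coeff3_def fps_mult_nth fps_sum_nth)

lemma coeff3_const_mult [simp]: "coeff3 (const3 c * F) i j k = c * coeff3 F i j k"
  by (simp add: coeff3_def const3_def)

lemma coeff3_var_y_mult [simp]:
  "coeff3 (var_y * F) i j k = (if j = 0 then 0 else coeff3 F i (j - 1) k)"
  by (simp add: coeff3_def var_y_def)

lemma coeff3_var_z_mult [simp]:
  "coeff3 (var_z * F) i j k = (if k = 0 then 0 else coeff3 F i j (k - 1))"
  by (simp add: coeff3_def var_z_def)

lemma coeff3_var_x_power:
  "coeff3 (var_x ^ n) i j k = (if i = n \<and> j = 0 \<and> k = 0 then 1 else 0)"
  by (simp add: coeff3_def var_x_def fps_X_power_nth)

lemma coeff3_var_y_square:
  "coeff3 (var_y ^ 2) i j k = (if i = 0 \<and> j = 2 \<and> k = 0 then 1 else 0)"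
  by (auto simp: coeff3_def var_y_def fps_X_power_nth)

lemma coeff3_fdiff_x [simp]: "coeff3 (fdiff_x F) i j k = (real i + 1) * coeff3 F (i + 1) j k"
  by (simp add: coeff3_def fdiff_x_def fps_mult_of_nat_nth algebra_simps)

lemma coeff3_fdiff_y [simp]: "coeff3 (fdiff_y F) i j k = (real j + 1) * coeff3 F i (j + 1) k"
  by (simp add: coeff3_def fdiff_y_def fps_mult_of_nat_nth algebra_simps)

lemma coeff3_fdiff_z [simp]: "coeff3 (fdiff_z F) i j k = (real k + 1) * coeff3 F i j (k + 1)"
  by (simp add: coeff3_def fdiff_z_def)

text \<open>Membership in the \<open>d\<close>-th power of the ideal generated by the three
  variables; this filtration replaces a metric.\<close>

definition vanishes_below :: "nat \<Rightarrow> fps3 \<Rightarrow> bool" where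
  "vanishes_below d F \<longleftrightarrow> (\<forall>i j k. i + j + k < d \<longrightarrow> coeff3 F i j k = 0)"

lemma vanishes_belowD: "vanishes_below d F \<Longrightarrow> i + j + k < d \<Longrightarrow> coeff3 F i j k = 0"
  by (simp add: vanishes_below_def)

lemma vanishes_below_0 [simp]: "vanishes_below 0 F"
  by (simp add: vanishes_below_def)

lemma vanishes_below_mono: "vanishes_below d F \<Longrightarrow> e \<le> d \<Longrightarrow> vanishes_below e F"
  by (simp add: vanishes_below_def)

lemma vanishes_below_add:
  "vanishes_below d F \<Longrightarrow> vanishes_below d G \<Longrightarrow> vanishes_below d (F + G)"
  by (simp add: vanishes_below_def)

lemma vanishes_below_diff:
  "vanishes_below d F \<Longrightarrow> vanishes_below d G \<Longrightarrow> vanishes_below d (F - G)"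
  by (simp add: vanishes_below_def)

lemma vanishes_below_mult:
  assumes "vanishes_below m F" "vanishes_below n G"
  shows "vanishes_below (m + n) (F * G)"
  unfolding vanishes_below_def
proof (intro allI impI)
  fix i j k :: nat
  assume deg: "i + j + k < m + n"
  have "coeff3 F a b c * coeff3 G (i - a) (j - b) (k - c) = 0"
    if "a \<le> i" "b \<le> j" "c \<le> k" for a b c
  proof (cases "a + b + c < m")
    case False
    then have "(i - a) + (j - b) + (k - c) < n"
      using deg that by linarith
    then show ?thesis
      using assms(2) by (simp add: vanishes_belowD)
  qed (use assms(1) in \<open>simp add: vanishes_belowD\<close>)
  then show "coeff3 (F * G) i j k = 0"
    unfolding coeff3_mult by (intro sum.neutral ballI) simp
qed

lemma vanishes_below_fdiff:
  assumes "vanishes_below d F"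
  shows "vanishes_below (d - 1) (fdiff_x F)" "vanishes_below (d - 1) (fdiff_y F)"
    "vanishes_below (d - 1) (fdiff_z F)"
  using assms by (auto simp: vanishes_below_def)

text \<open>Banach's fixed point theorem for the degree filtration.\<close>

lemma degree_contraction_fixpoint:
  assumes contr: "\<And>d F G. vanishes_below d (F - G) \<Longrightarrow> vanishes_below (Suc d) (T F - T G)"
  shows "\<exists>F. T F = F"
proof -
  define S where "S n = (T ^^ n) 0" for n
  have S_Suc: "S (Suc n) = T (S n)" for n
    by (simp add: S_def)
  have step: "vanishes_below n (S (Suc n) - S n)" for n
    by (induction n) (use contr S_Suc in auto)
  have stable: "coeff3 (S (n + m)) i j k = coeff3 (S n) i j k" if "i + j + k < n" for n m i j k
  proof (induction m)
    case (Suc m)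
    have "coeff3 (S (Suc (n + m)) - S (n + m)) i j k = 0"
      by (rule vanishes_belowD[OF step]) (use that in simp)
    with Suc show ?case by simp
  qed simp
  \<comment> \<open>Iterates from index \<open>Suc (i + j + k)\<close> on share this
    coefficient.\<close>
  define F where "F = Abs_fps3 (\<lambda>i j k. coeff3 (S (Suc (i + j + k))) i j k)"
  have lim: "vanishes_below n (F - S n)" for n
    unfolding vanishes_below_def
  proof (intro allI impI)
    fix i j k assume "i + j + k < n"
    then obtain m where "n = Suc (i + j + k) + m"
      using less_imp_Suc_add by auto
    then show "coeff3 (F - S n) i j k = 0"
      using stable[of i j k "Suc (i + j + k)" m] by (simp add: F_def)
  qed
  have "T F = F"
  proof (rule fps3_eqI)
    fix i j k
    \<comment> \<open>\<open>F\<close> is compared with one iterate earlier for \<open>T F\<close>,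
      since \<open>contr\<close> supplies the missing degree.\<close>
    have "coeff3 (T F - S (Suc (i + j + k))) i j k = 0" "coeff3 (F - S (Suc (i + j + k))) i j k = 0"
      using vanishes_belowD[OF contr[OF lim[of "i + j + k"]]]
        vanishes_belowD[OF lim[of "Suc (i + j + k)"]] by (simp_all add: S_Suc)
    then show "coeff3 (T F) i j k = coeff3 F i j k"
      by simp
  qed
  then show ?thesis ..
qed

subsection \<open>The linear part of the vector field\<close>

definition linear_vf :: "real \<Rightarrow> fps3 \<Rightarrow> fps3" where
  "linear_vf lam F = var_y * fdiff_x F + const3 (- lam) * var_z * fdiff_z F"

text \<open>For fixed \<open>k > 0\<close> the system is triangular in \<open>j\<close>, with
  diagonal entry \<open>- lam * real k\<close>.\<close>

lemma coeff3_linear_vf: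
  "coeff3 (linear_vf lam F) i j k =
     (if j = 0 then 0 else (real i + 1) * coeff3 F (i + 1) (j - 1) k) - lam * real k * coeff3 F i j k"
  by (cases k) (auto simp: linear_vf_def mult.assoc)

text \<open>For \<open>k = 0\<close> and \<open>i = 0\<close> the value is \<open>0\<close> by the convention \<open>x / 0 = 0\<close>.\<close>

primrec linear_solve_coeff :: "real \<Rightarrow> fps3 \<Rightarrow> nat \<Rightarrow> nat \<Rightarrow> nat \<Rightarrow> real" where
  "linear_solve_coeff lam G 0 i k =
     (if k = 0 then coeff3 G (i - 1) 1 0 / real i else - coeff3 G i 0 k / (lam * real k))"
| "linear_solve_coeff lam G (Suc j) i k =
     (if k = 0 then coeff3 G (i - 1) (Suc (Suc j)) 0 / real i
      else ((real i + 1) * linear_solve_coeff lam G j (i + 1) k - coeff3 G i (Suc j) k) / (lam * real k))"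

definition linear_solve :: "real \<Rightarrow> fps3 \<Rightarrow> fps3" where
  "linear_solve lam G = Abs_fps3 (\<lambda>i j k. linear_solve_coeff lam G j i k)"

lemma linear_solve_coeff_diff:
  "linear_solve_coeff lam (F - G) j i k =
     linear_solve_coeff lam F j i k - linear_solve_coeff lam G j i k"
  by (induction j arbitrary: i) (auto simp: diff_divide_distrib right_diff_distrib)

lemma linear_solve_diff: "linear_solve lam (F - G) = linear_solve lam F - linear_solve lam G"
  by (rule fps3_eqI) (simp add: linear_solve_def linear_solve_coeff_diff)

lemma vanishes_below_linear_solve:
  assumes "vanishes_below d G"
  shows "vanishes_below d (linear_solve lam G)"
proof -
  have "linear_solve_coeff lam G j i k = 0" if "i + j + k < d" for i j k
    using that
  proof (induction j arbitrary: i)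
    case 0
    \<comment> \<open>For \<open>i = 0\<close> the truncated \<open>i - 1\<close> points to an entry
      of the wrong degree, but division by zero discards it.\<close>
    then show ?case using assms by (cases i) (auto simp: vanishes_below_def)
  next
    case (Suc j)
    then show ?case using assms by (cases i) (auto simp: vanishes_below_def)
  qed
  then show ?thesis
    by (simp add: vanishes_below_def linear_solve_def)
qed

text \<open>The exception is unavoidable: both terms of \<open>linear_vf\<close> carry a factor
  \<open>y\<close> or \<open>z\<close>.\<close>

lemma linear_vf_linear_solve:
  assumes "lam \<noteq> 0"
  shows "coeff3 (linear_vf lam (linear_solve lam G)) i j k =
           (if j = 0 \<and> k = 0 then 0 else coeff3 G i j k)"
proof (cases "k = 0")
  case True
  have "real i + 1 \<noteq> 0" by linarith
  moreover have "linear_solve_coeff lam G m (Suc i) 0 = coeff3 G i (Suc m) 0 / (real i + 1)" for m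
    by (cases m) (auto simp: add.commute)
  ultimately show ?thesis
    using True by (cases j) (auto simp: coeff3_linear_vf linear_solve_def)
next
  case False
  then show ?thesis
    using assms by (cases j) (auto simp: coeff3_linear_vf linear_solve_def)
qed

subsection \<open>The nonlinear part of the vector field\<close>

definition derivation3 :: "fps3 \<Rightarrow> fps3 \<Rightarrow> fps3 \<Rightarrow> fps3 \<Rightarrow> fps3" where
  "derivation3 p q r F = p * fdiff_x F + q * fdiff_y F + r * fdiff_z F"

lemma formal_vf_split:
  "formal_vf lam P Q R F = linear_vf lam F +
     derivation3 (taylor_series3 P) (taylor_series3 Q) (taylor_series3 R) F"
  by (simp add: formal_vf_def linear_vf_def derivation3_def algebra_simps)

lemma derivation3_diff: "derivation3 p q r (F - G) = derivation3 p q r F - derivation3 p q r G"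
proof -
  have "fdiff_x (F - G) = fdiff_x F - fdiff_x G" "fdiff_y (F - G) = fdiff_y F - fdiff_y G"
    "fdiff_z (F - G) = fdiff_z F - fdiff_z G"
    by (auto intro!: fps3_eqI simp: right_diff_distrib)
  then show ?thesis
    by (simp only: derivation3_def) (simp add: algebra_simps)
qed

text \<open>Differentiation costs one degree, and multiplication by \<open>p\<close>,
  \<open>q\<close> or \<open>r\<close> gains two.\<close>

lemma vanishes_below_derivation3:
  assumes "vanishes_below 2 p" "vanishes_below 2 q" "vanishes_below 2 r" "vanishes_below d F"
  shows "vanishes_below (Suc d) (derivation3 p q r F)"
proof -
  \<comment> \<open>The bound exceeds \<open>Suc d\<close> when \<open>d = 0\<close>, because of
    truncated subtraction.\<close>
  have "vanishes_below (2 + (d - 1)) (derivation3 p q r F)"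
    unfolding derivation3_def
    by (intro vanishes_below_add[OF vanishes_below_add] vanishes_below_mult assms
        vanishes_below_fdiff)
  then show ?thesis
    by (rule vanishes_below_mono) simp
qed

lemma coeff3_derivation3_var_y_square:
  "coeff3 (derivation3 p q r (var_y ^ 2)) i 0 0 = 0"
  by (simp add: derivation3_def coeff3_mult coeff3_var_y_square)

lemma vanishes_below_taylor_series3:
  assumes "jet3 1 f = 0"
  shows "vanishes_below 2 (taylor_series3 f)"
  unfolding vanishes_below_def
proof (intro allI impI)
  fix i j k :: nat
  assume "i + j + k < 2"
  moreover have "coeff3 (jet3 1 f) i j k = 0"
    by (subst assms) simp
  ultimately show "coeff3 (taylor_series3 f) i j k = 0"
    by (simp add: jet3_def)
qed

theorem formal_normal_form:
  assumes "lam \<noteq> 0" "vanishes_below 2 p" "vanishes_below 2 q" "vanishes_below 2 r"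
  shows "\<exists>H. vanishes_below 3 (H - var_y ^ 2) \<and>
             (\<forall>i j k. coeff3 (linear_vf lam H + derivation3 p q r H) i j k \<noteq> 0 \<longrightarrow>
                      4 \<le> i \<and> j = 0 \<and> k = 0)"
proof -
  let ?N = "derivation3 p q r"
  note raise = vanishes_below_derivation3[OF assms(2-4)]
  have "vanishes_below (Suc d) (var_y ^ 2 - linear_solve lam (?N F) - (var_y ^ 2 - linear_solve lam (?N G)))"
    if "vanishes_below d (F - G)" for d F G
  proof -
    \<comment> \<open>The \<open>y^2\<close> terms cancel and the minus sign swaps \<open>F\<close>
      and \<open>G\<close>.\<close>
    have "vanishes_below (Suc d) (linear_solve lam (?N (G - F)))"
      by (intro vanishes_below_linear_solve raise) (use that in \<open>simp add: vanishes_below_def\<close>)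
    then show ?thesis
      by (simp add: derivation3_diff linear_solve_diff algebra_simps)
  qed
  then obtain H where H: "var_y ^ 2 - linear_solve lam (?N H) = H"
    using degree_contraction_fixpoint[of "\<lambda>F. var_y ^ 2 - linear_solve lam (?N F)"] by auto
  have y2: "vanishes_below 2 (var_y ^ 2)"
    by (simp add: vanishes_below_def coeff3_var_y_square)
  \<comment> \<open>Bootstrapping in the fixed point equation: \<open>var_y ^ 2\<close> limits the
    order of \<open>H\<close> to two.\<close>
  have raise_H: "vanishes_below (Suc d) H" if "vanishes_below d H" "Suc d \<le> 2" for d
    by (subst H[symmetric])
      (intro vanishes_below_diff vanishes_below_linear_solve raise that vanishes_below_mono[OF y2])
  have "vanishes_below 2 H"
    using raise_H[of 0] raise_H[of 1] by (simp add: numeral_2_eq_2)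
  then have N3: "vanishes_below 3 (?N H)"
    using raise[of 2 H] by (simp add: numeral_3_eq_3)
  have "vanishes_below 3 (0 - linear_solve lam (?N H))"
    by (intro vanishes_below_diff vanishes_below_linear_solve N3) (simp add: vanishes_below_def)
  moreover have "H - var_y ^ 2 = 0 - linear_solve lam (?N H)"
    using H by (simp add: algebra_simps)
  ultimately have H3: "vanishes_below 3 (H - var_y ^ 2)"
    by simp
  have coeff_H: "coeff3 H i j k = coeff3 (var_y ^ 2) i j k - coeff3 (linear_solve lam (?N H)) i j k" for i j k
    by (subst H[symmetric]) simp
  \<comment> \<open>The linear part kills \<open>y^2\<close>, which contains neither
    \<open>x\<close> nor \<open>z\<close>.\<close>
  have "coeff3 (linear_vf lam H) i j k = - coeff3 (linear_vf lam (linear_solve lam (?N H))) i j k"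
    for i j k
    unfolding coeff3_linear_vf coeff_H by (simp add: coeff3_var_y_square algebra_simps)
  then have X: "coeff3 (linear_vf lam H + ?N H) i j k = (if j = 0 \<and> k = 0 then coeff3 (?N H) i j k else 0)"
    for i j k
    by (simp add: linear_vf_linear_solve[OF assms(1)])
  \<comment> \<open>Split \<open>H\<close> as \<open>y^2\<close> plus a remainder of order three:
    \<open>?N\<close> sends the remainder to order four, and \<open>?N (var_y ^ 2)\<close> has no
    pure powers of \<open>x\<close>.\<close>
  have "coeff3 (?N H) i 0 0 = 0" if "i < 4" for i
    using vanishes_belowD[OF raise[OF H3], of i 0 0] that
    by (simp add: derivation3_diff coeff3_derivation3_var_y_square)
  then have "4 \<le> i \<and> j = 0 \<and> k = 0" if "coeff3 (linear_vf lam H + ?N H) i j k \<noteq> 0" for i j k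
    using that X[of i j k] by (metis not_le)
  with H3 show ?thesis by blast
qed

subsection \<open>Formal sums\<close>

text \<open>If \<open>F n\<close> is the degree \<open>n\<close> part of \<open>S\<close>, a
  coefficient meets a single summand, reached once \<open>N\<close> is at least its degree.\<close>

lemma formal_sums_fromI:
  assumes "\<And>n i j k. coeff3 (F n) i j k = (if i + j + k = n then coeff3 S i j k else 0)"
    and "vanishes_below m S"
  shows "formal_sums_from m F S"
  unfolding formal_sums_from_def
proof (intro allI)
  fix i j k
  have "coeff3 (\<Sum>n=m..N. F n) i j k = coeff3 S i j k" if "N \<ge> i + j + k" for N
    using that assms(2) by (auto simp: assms(1) vanishes_below_def not_le)
  then show "\<forall>\<^sub>F N in sequentially. coeff3 (\<Sum>n=m..N. F n) i j k = coeff3 S i j k"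
    using eventually_sequentially by blast
qed

theorem theorem28:
  fixes lam :: real
    and P Q R :: "real \<times> real \<times> real \<Rightarrow> real"
    and U :: "(real \<times> real \<times> real) set"
  assumes "lam \<noteq> 0"
    and "open U" and "(0, 0, 0) \<in> U"
    and "real_analytic_on3 P U" and "real_analytic_on3 Q U" and "real_analytic_on3 R U"
    and "jet3 1 P = 0" and "jet3 1 Q = 0" and "jet3 1 R = 0"
  shows "\<exists>(H :: fps3) (Hn :: nat \<Rightarrow> fps3) (\<omega> :: nat \<Rightarrow> real).
           (\<forall>n\<ge>3. homogeneous3 n (Hn n)) \<and>
           formal_sums_from 3 Hn (H - var_y ^ 2) \<and>
           formal_sums_from 4 (\<lambda>n. const3 (\<omega> n) * var_x ^ n) (formal_vf lam P Q R H)"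
proof -
  obtain H where H3: "vanishes_below 3 (H - var_y ^ 2)"
    and X: "\<And>i j k. coeff3 (formal_vf lam P Q R H) i j k \<noteq> 0 \<Longrightarrow> 4 \<le> i \<and> j = 0 \<and> k = 0"
    using formal_normal_form[OF assms(1) assms(7-9)[THEN vanishes_below_taylor_series3]]
    unfolding formal_vf_split by blast
  define Hn where
    "Hn n = Abs_fps3 (\<lambda>i j k. if i + j + k = n then coeff3 (H - var_y ^ 2) i j k else 0)" for n
  define \<omega> where "\<omega> n = coeff3 (formal_vf lam P Q R H) n 0 0" for n
  have "\<forall>n\<ge>3. homogeneous3 n (Hn n)"
    by (simp add: homogeneous3_def Hn_def)
  moreover have "formal_sums_from 3 Hn (H - var_y ^ 2)"
    by (rule formal_sums_fromI[OF _ H3]) (simp add: Hn_def)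
  moreover have "formal_sums_from 4 (\<lambda>n. const3 (\<omega> n) * var_x ^ n) (formal_vf lam P Q R H)"
  \<comment> \<open>As only pure powers of \<open>x\<close> survive, the term with
    \<open>x^n\<close> is the whole degree \<open>n\<close> part.\<close>
  proof (rule formal_sums_fromI)
    show "vanishes_below 4 (formal_vf lam P Q R H)"
      using X by (fastforce simp: vanishes_below_def)
    show "coeff3 (const3 (\<omega> n) * var_x ^ n) i j k =
            (if i + j + k = n then coeff3 (formal_vf lam P Q R H) i j k else 0)" for n i j k
      using X[of i j k]
      by (cases "coeff3 (formal_vf lam P Q R H) i j k = 0") (auto simp: \<omega>_def coeff3_var_x_power)
  qed
  ultimately show ?thesis by blast
qed

end
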